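(* Let $H_1,\dots,H_k$ be $n\times n$ Hermitian matrices. Let $\left([H_i,H_j]\right)$ and $\left(\{H_i,H_j\}\right)$ denote the $k\times k$ block matrices (elements of $M_{kn}(\mathbb{C})$) whose $(i,j)$ blocks are $[H_i,H_j]$ and $\{H_i,H_j\}$ respectively. Then $$\left\|\left([H_i,H_j]\right)\right\|_1\le (k-1)\,\mathrm{tr}\left(\{H_i,H_j\}\right),$$ where on the right-hand side $\mathrm{tr}$ is the trace of the full $kn\times kn$ block matrix.
   Context: $[X,Y]=XY-YX$ is the commutator and $\{X,Y\}=XY+YX$ is the anti-commutator. $\|X\|_1=\mathrm{tr}\,|X|=\mathrm{tr}\,(X^*X)^{1/2}$ is the trace norm, and $\mathrm{tr}$ is the usual (unnormalized) trace. *)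

theory Defs
  imports "Jordan_Normal_Form.Schur_Decomposition"
begin

definition commutator :: "complex mat \<Rightarrow> complex mat \<Rightarrow> complex mat" where
  "commutator X Y = X * Y - Y * X"

definition anticommutator :: "complex mat \<Rightarrow> complex mat \<Rightarrow> complex mat" where
  "anticommutator X Y = X * Y + Y * X"

definition mat_trace :: "complex mat \<Rightarrow> complex" where
  "mat_trace A = (\<Sum>i<dim_row A. A $$ (i, i))"

text \<open>The equation forces the matrix to be square, since the adjoint swaps the dimensions.\<close>

definition hermitian :: "complex mat \<Rightarrow> bool" where
  "hermitian A \<longleftrightarrow> mat_adjoint A = A"

definition positive_semidefinite :: "complex mat \<Rightarrow> bool" where
  "positive_semidefinite A \<longleftrightarrow>
     hermitian A \<and> (\<forall>v \<in> carrier_vec (dim_row A). Re ((A *\<^sub>v v) \<bullet>c v) \<ge> 0)"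

text \<open>The positive semidefinite square root; meaningful for positive semidefinite arguments,
  for which it exists and is unique.\<close>

definition psd_sqrt :: "complex mat \<Rightarrow> complex mat" where
  "psd_sqrt A = (THE B. positive_semidefinite B \<and> B * B = A)"

definition mat_abs :: "complex mat \<Rightarrow> complex mat" where
  "mat_abs X = psd_sqrt (mat_adjoint X * X)"

text \<open>The trace of a positive semidefinite matrix is real, so taking the real part loses nothing.\<close>

definition trace_norm :: "complex mat \<Rightarrow> real" where
  "trace_norm X = Re (mat_trace (mat_abs X))"

text \<open>The \<open>k * n\<close> by \<open>k * n\<close> matrix whose \<open>(i, j)\<close> block, for \<open>i, j < k\<close>, is the \<open>n\<close> by \<open>n\<close>
  matrix \<open>B i j\<close>.\<close>

definition block_mat :: "nat \<Rightarrow> nat \<Rightarrow> (nat \<Rightarrow> nat \<Rightarrow> complex mat) \<Rightarrow> complex mat" where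
  "block_mat k n B =
     mat (k * n) (k * n) (\<lambda>(a, b). B (a div n) (b div n) $$ (a mod n, b mod n))"

end

theory Submission
  imports Defs "Jordan_Normal_Form.Spectral_Radius"
begin

text \<open>The block matrix \<open>C = ([H\<^sub>i, H\<^sub>j])\<close> is Hermitian, because the adjoint of
  \<open>[H\<^sub>i, H\<^sub>j]\<close> is \<open>[H\<^sub>j, H\<^sub>i]\<close>. Its trace norm is therefore the sum of the
  absolute values of its eigenvalues (\<open>trace_norm_spectral\<close>).

  Let \<open>u\<close> be a unit eigenvector with blocks \<open>x\<^sub>1, \<dots>, x\<^sub>k\<close>. Its eigenvalue is
  \<open>\<langle>C u, u\<rangle>\<close>, which is the sum over \<open>i \<noteq> j\<close> of
  \<open>\<langle>H\<^sub>j x\<^sub>j, H\<^sub>i x\<^sub>i\<rangle> - \<langle>H\<^sub>i x\<^sub>j, H\<^sub>j x\<^sub>i\<rangle>\<close>; the diagonal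
  blocks of \<open>C\<close> vanish. Since \<open>2 \<bar>\<langle>a, b\<rangle>\<bar> \<le> \<parallel>a\<parallel>\<^sup>2 + \<parallel>b\<parallel>\<^sup>2\<close>, its
  absolute value is at most half the sum over \<open>i \<noteq> j\<close> of
  \<open>\<parallel>H\<^sub>i x\<^sub>i\<parallel>\<^sup>2 + \<parallel>H\<^sub>j x\<^sub>j\<parallel>\<^sup>2 + \<parallel>H\<^sub>j x\<^sub>i\<parallel>\<^sup>2 + \<parallel>H\<^sub>i x\<^sub>j\<parallel>\<^sup>2\<close>
  (\<open>commutator_form_bound\<close>).

  Now let \<open>u\<close> run through an orthonormal eigenbasis. The \<open>j\<close>-th blocks then form a Parseval
  frame, so the sum of \<open>\<parallel>H\<^sub>i x\<^sub>j\<parallel>\<^sup>2\<close> over the basis is the squared Frobenius norm of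
  \<open>H\<^sub>i\<close>, whatever \<open>j\<close> is (\<open>unitary_rows_parseval\<close>). Each index belongs to
  \<open>2 (k - 1)\<close> ordered pairs, so the trace norm is at most \<open>2 (k - 1)\<close> times the sum of the
  squared Frobenius norms. The trace of the anticommutator block matrix is twice that sum.

  The eigenbasis comes from the spectral theorem for Hermitian matrices, proved here by
  deflation. The trace norm is defined through a square root that is a definite description, so
  computing it also rests on the uniqueness of positive semidefinite square roots.\<close>

section \<open>Adjoints\<close>

lemma mat_adjoint_eq_mat:
  "mat_adjoint A = mat (dim_col A) (dim_row A) (\<lambda>(i, j). cnj (A $$ (j, i)))"
  by (rule eq_matI) (auto simp: mat_adjoint_def mat_of_rows_def)

lemma dim_mat_adjoint [simp]:
  "dim_row (mat_adjoint A) = dim_col (A :: complex mat)"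
  "dim_col (mat_adjoint A) = dim_row (A :: complex mat)"
  by (simp_all add: mat_adjoint_eq_mat)

lemma index_mat_adjoint [simp]:
  "i < dim_col A \<Longrightarrow> j < dim_row A \<Longrightarrow> mat_adjoint A $$ (i, j) = cnj (A $$ (j, i))"
  by (simp add: mat_adjoint_eq_mat)

lemma mat_adjoint_carrier [simp]:
  "(A :: complex mat) \<in> carrier_mat m n \<Longrightarrow> mat_adjoint A \<in> carrier_mat n m"
  by (rule carrier_matI) simp_all

lemma mat_adjoint_adjoint [simp]: "mat_adjoint (mat_adjoint A) = (A :: complex mat)"
  by (rule eq_matI) auto

lemma mat_adjoint_mult:
  assumes "(A :: complex mat) \<in> carrier_mat m n" "B \<in> carrier_mat n l"
  shows "mat_adjoint (A * B) = mat_adjoint B * mat_adjoint A"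
  using assms by (intro eq_matI) (auto simp: scalar_prod_def mult.commute)

lemma mat_adjoint_diag_real [simp]:
  "mat_adjoint (mat_diag n (\<lambda>i. complex_of_real (d i))) = mat_diag n (\<lambda>i. complex_of_real (d i))"
  by (rule eq_matI) (auto simp: mat_diag_def)

lemma hermitian_iff_index:
  assumes "A \<in> carrier_mat n n"
  shows "hermitian A \<longleftrightarrow> (\<forall>i<n. \<forall>j<n. A $$ (i, j) = cnj (A $$ (j, i)))"
proof
  assume herm: "hermitian A"
  show "\<forall>i<n. \<forall>j<n. A $$ (i, j) = cnj (A $$ (j, i))"
  proof (intro allI impI)
    fix i j assume "i < n" "j < n"
    then have "mat_adjoint A $$ (i, j) = cnj (A $$ (j, i))" using assms by simp
    then show "A $$ (i, j) = cnj (A $$ (j, i))" using herm by (simp add: hermitian_def)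
  qed
next
  assume sym: "\<forall>i<n. \<forall>j<n. A $$ (i, j) = cnj (A $$ (j, i))"
  show "hermitian A"
    unfolding hermitian_def
  proof (rule eq_matI)
    fix i j assume "i < dim_row A" "j < dim_col A"
    then show "mat_adjoint A $$ (i, j) = A $$ (i, j)"
      using assms sym[rule_format, of j i] by simp
  qed (use assms in auto)
qed

section \<open>Unitary matrices\<close>

definition unitary :: "nat \<Rightarrow> complex mat \<Rightarrow> bool" where
  "unitary n U \<longleftrightarrow> U \<in> carrier_mat n n \<and> mat_adjoint U * U = 1\<^sub>m n \<and> U * mat_adjoint U = 1\<^sub>m n"

lemma unitaryI:
  assumes "U \<in> carrier_mat n n" "mat_adjoint U * U = 1\<^sub>m n"
  shows "unitary n U"
  unfolding unitary_def
  using assms mat_mult_left_right_inverse[OF mat_adjoint_carrier[OF assms(1)] assms(1,2)] by blast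

lemma unitary_mult:
  assumes "unitary n U" "unitary n V"
  shows "unitary n (U * V)"
proof (rule unitaryI)
  have U: "U \<in> carrier_mat n n" "mat_adjoint U * U = 1\<^sub>m n"
    and V: "V \<in> carrier_mat n n" "mat_adjoint V * V = 1\<^sub>m n"
    using assms by (auto simp: unitary_def)
  show "U * V \<in> carrier_mat n n" using U V by simp
  have "mat_adjoint (U * V) * (U * V) = mat_adjoint V * (mat_adjoint U * (U * V))"
    using U V by (simp add: mat_adjoint_mult[OF U(1) V(1)] assoc_mult_mat[of _ n n _ n _ n])
  also have "mat_adjoint U * (U * V) = V"
    using U V by (simp flip: assoc_mult_mat[of _ n n _ n _ n])
  finally show "mat_adjoint (U * V) * (U * V) = 1\<^sub>m n" using V by simp
qed

lemma unitary_rows_orthonormal: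
  assumes "unitary n U" "a < n" "b < n"
  shows "(\<Sum>m<n. U $$ (a, m) * cnj (U $$ (b, m))) = (if a = b then 1 else 0)"
proof -
  have U: "U \<in> carrier_mat n n" "U * mat_adjoint U = 1\<^sub>m n"
    using assms by (auto simp: unitary_def)
  have "(U * mat_adjoint U) $$ (a, b) = (\<Sum>m<n. U $$ (a, m) * cnj (U $$ (b, m)))"
    using U(1) assms by (simp add: scalar_prod_def atLeast0LessThan)
  then show ?thesis using U assms by simp
qed

lemma unitary_cols_orthonormal:
  assumes "unitary n U" "a < n" "b < n"
  shows "(\<Sum>r<n. cnj (U $$ (r, a)) * U $$ (r, b)) = (if a = b then 1 else 0)"
proof -
  have U: "U \<in> carrier_mat n n" "mat_adjoint U * U = 1\<^sub>m n"
    using assms by (auto simp: unitary_def)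
  have "(mat_adjoint U * U) $$ (a, b) = (\<Sum>r<n. cnj (U $$ (r, a)) * U $$ (r, b))"
    using U(1) assms by (simp add: scalar_prod_def atLeast0LessThan)
  then show ?thesis using U assms by simp
qed

lemma cscalar_prod_self: "v \<bullet>c v = complex_of_real (\<Sum>i<dim_vec v. (cmod (v $ i))\<^sup>2)"
  by (simp add: scalar_prod_def complex_norm_square atLeast0LessThan del: of_real_power)

text \<open>Completing \<open>v\<close> to a basis and applying Gram-Schmidt leaves \<open>v\<close> in first place; scaling the
  resulting orthogonal vectors to unit length gives the columns of \<open>W\<close>.\<close>

lemma unitary_with_first_column:
  assumes v: "v \<in> carrier_vec n" and v0: "v \<noteq> 0\<^sub>v n"
  obtains W c where "unitary n W" "col W 0 = c \<cdot>\<^sub>v v"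
proof -
  interpret cof_vec_space n "TYPE(complex)" .
  have n: "n > 0" using v v0 by (cases n) auto
  define b where "b = basis_completion v"
  from basis_completion[OF v v0, folded b_def]
  have b: "distinct b" "\<not> lin_dep (set b)" "set b \<subseteq> carrier_vec n" "hd b = v" "length b = n"
    by auto
  then obtain vs where bv: "b = v # vs" using n by (cases b) auto
  define ws where "ws = gram_schmidt n b"
  from gram_schmidt_result[OF b(3,1,2) ws_def]
  have ws: "set ws \<subseteq> carrier_vec n" "corthogonal ws" "length ws = n" by (auto simp: b)
  have hdws: "hd ws = v" unfolding ws_def bv by (rule gram_schmidt_hd[OF v])
  define c where "c i = complex_of_real (1 / sqrt (Re (ws ! i \<bullet>c ws ! i)))" for i
  define W where "W = mat_of_cols n (map (\<lambda>i. c i \<cdot>\<^sub>v ws ! i) [0..<n])"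
  have W: "W \<in> carrier_mat n n" unfolding W_def by auto
  have wsc: "ws ! i \<in> carrier_vec n" if "i < n" for i using ws that by auto
  have colW: "col W i = c i \<cdot>\<^sub>v ws ! i" if "i < n" for i
    unfolding W_def using that wsc by simp
  have norm: "cnj (c i) * c i * (ws ! i \<bullet>c ws ! i) = 1" if "i < n" for i
  proof -
    have "ws ! i \<bullet>c ws ! i \<noteq> 0" using corthogonalD[OF ws(2), of i i] that ws(3) by simp
    then obtain r where r: "ws ! i \<bullet>c ws ! i = complex_of_real r" "r > 0"
      using cscalar_prod_self[of "ws ! i"]
      by (metis of_real_0 less_eq_real_def sum_nonneg zero_le_power2)
    show ?thesis unfolding c_def r(1) using r(2) 
      by (simp flip: of_real_mult)
  qed
  have "mat_adjoint W * W = 1\<^sub>m n"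
  proof (rule eq_matI)
    fix i j assume "i < dim_row (1\<^sub>m n :: complex mat)" "j < dim_col (1\<^sub>m n :: complex mat)"
    then have i: "i < n" and j: "j < n" by auto
    have "row (mat_adjoint W) i = conjugate (col W i)"
      using W i by (intro eq_vecI) auto
    then have "(mat_adjoint W * W) $$ (i, j) = conjugate (c i \<cdot>\<^sub>v ws ! i) \<bullet> (c j \<cdot>\<^sub>v ws ! j)"
      using W i j by (simp add: colW)
    also have "\<dots> = cnj (c i) * c j * (ws ! j \<bullet>c ws ! i)"
      using wsc[OF i] wsc[OF j] by (simp add: scalar_prod_def sum_distrib_left ac_simps)
    also have "\<dots> = (if i = j then 1 else 0)"
      using norm[OF i] corthogonalD[OF ws(2), of j i] i j ws(3) by auto
    finally show "(mat_adjoint W * W) $$ (i, j) = 1\<^sub>m n $$ (i, j)" using i j by simp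
  qed (use W in auto)
  then have "unitary n W" by (rule unitaryI[OF W])
  moreover have "col W 0 = c 0 \<cdot>\<^sub>v v"
    using colW[OF n] hdws n ws(3) by (simp add: hd_conv_nth flip: length_greater_0_conv)
  ultimately show thesis by (rule that)
qed

section \<open>The spectral theorem for Hermitian matrices\<close>

lemma mat_adjoint_four_block_diag:
  assumes "(A :: complex mat) \<in> carrier_mat n n" "B \<in> carrier_mat m m"
  shows "mat_adjoint (four_block_mat A (0\<^sub>m n m) (0\<^sub>m m n) B)
    = four_block_mat (mat_adjoint A) (0\<^sub>m n m) (0\<^sub>m m n) (mat_adjoint B)"
proof (rule eq_matI)
  have dims: "dim_row A = n" "dim_col A = n" "dim_row B = m" "dim_col B = m"
    using assms by auto
  fix i j
  assume "i < dim_row (four_block_mat (mat_adjoint A) (0\<^sub>m n m) (0\<^sub>m m n) (mat_adjoint B))"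
    and "j < dim_col (four_block_mat (mat_adjoint A) (0\<^sub>m n m) (0\<^sub>m m n) (mat_adjoint B))"
  then have "i < n + m" "j < n + m" by (simp_all add: dims)
  then show "mat_adjoint (four_block_mat A (0\<^sub>m n m) (0\<^sub>m m n) B) $$ (i, j)
    = four_block_mat (mat_adjoint A) (0\<^sub>m n m) (0\<^sub>m m n) (mat_adjoint B) $$ (i, j)"
    by (cases "i < n"; cases "j < n") (simp_all add: dims)
qed (use assms in simp_all)

lemma mult_four_block_diag:
  assumes A: "(A :: complex mat) \<in> carrier_mat n n" and B: "B \<in> carrier_mat m m"
    and C: "C \<in> carrier_mat n n" and D: "D \<in> carrier_mat m m"
  shows "four_block_mat A (0\<^sub>m n m) (0\<^sub>m m n) B * four_block_mat C (0\<^sub>m n m) (0\<^sub>m m n) D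
    = four_block_mat (A * C) (0\<^sub>m n m) (0\<^sub>m m n) (B * D)"
  unfolding mult_four_block_mat[OF A zero_carrier_mat zero_carrier_mat B C zero_carrier_mat
      zero_carrier_mat D]
  using assms by simp

text \<open>Deflation: a unitary whose first column is an eigenvector conjugates \<open>A\<close> to a Hermitian matrix
  with first column \<open>(e, 0, \<dots>, 0)\<close>. By symmetry the first row is \<open>(e, 0, \<dots>, 0)\<close> as well and \<open>e\<close> is
  real, so the matrix splits off a block of size one less, to which the induction hypothesis
  applies.\<close>

theorem hermitian_spectral_decomposition:
  assumes "A \<in> carrier_mat n n" "hermitian A"
  obtains U d where "unitary n U"
    "A = U * mat_diag n (\<lambda>i. complex_of_real (d i)) * mat_adjoint U"
proof -
  have "\<exists>U d. unitary n U \<and> A = U * mat_diag n (\<lambda>i. complex_of_real (d i)) * mat_adjoint U"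
    using assms
  proof (induction n arbitrary: A)
    case 0
    then show ?case
      by (intro exI[of _ "1\<^sub>m 0"]) (auto simp: unitary_def intro!: eq_matI)
  next
    case (Suc m)
    note A = Suc.prems(1)
    let ?n = "Suc m"
    note assoc = assoc_mult_mat[of _ ?n ?n _ ?n _ ?n]
    note carr = mult_carrier_mat[of _ ?n ?n _ ?n]
    obtain e v where "eigenvector A v e"
      using spectrum_non_empty[OF A] unfolding spectrum_def eigenvalue_def by auto
    then have v: "v \<in> carrier_vec ?n" "v \<noteq> 0\<^sub>v ?n" and Av: "A *\<^sub>v v = e \<cdot>\<^sub>v v"
      using A by (auto simp: eigenvector_def)
    obtain W c where W: "unitary ?n W" and col0: "col W 0 = c \<cdot>\<^sub>v v"
      by (rule unitary_with_first_column[OF v])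
    have Wc: "W \<in> carrier_mat ?n ?n" and WW: "W * mat_adjoint W = 1\<^sub>m ?n"
      and WW': "mat_adjoint W * W = 1\<^sub>m ?n"
      using W by (auto simp: unitary_def)
    note Wc' = mat_adjoint_carrier[OF Wc]
    define C where "C = mat_adjoint W * A * W"
    have C: "C \<in> carrier_mat ?n ?n" unfolding C_def using Wc A by (simp add: carr)
    have "mat_adjoint C = C"
      unfolding C_def using Wc Wc' A Suc.prems(2)
      by (simp add: hermitian_def mat_adjoint_mult[of _ ?n ?n _ ?n] assoc carr)
    then have hC: "hermitian C" by (simp add: hermitian_def)
    then have C_cnj: "C $$ (i, j) = cnj (C $$ (j, i))" if "i < ?n" "j < ?n" for i j
      using that hermitian_iff_index[OF C] by blast
    have C0: "C $$ (i, 0) = (if i = 0 then e else 0)" if i: "i < ?n" for i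
    proof -
      have "col (A * W) 0 = A *\<^sub>v (c \<cdot>\<^sub>v v)"
        using col_mult2[OF A Wc, of 0] col0 by simp
      also have "\<dots> = c \<cdot>\<^sub>v (A *\<^sub>v v)" by (rule mult_mat_vec[OF A v(1)])
      also have "\<dots> = e \<cdot>\<^sub>v col W 0"
        unfolding Av col0 by (simp add: smult_smult_assoc mult.commute)
      finally have "col (A * W) 0 = e \<cdot>\<^sub>v col W 0" .
      then have "C $$ (i, 0) = row (mat_adjoint W) i \<bullet> (e \<cdot>\<^sub>v col W 0)"
        unfolding C_def using i A Wc Wc' by (simp add: assoc carr)
      also have "\<dots> = e * (mat_adjoint W * W) $$ (i, 0)"
        using i Wc by simp
      finally show ?thesis using i WW' by simp
    qed
    have e_real: "complex_of_real (Re e) = e"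
      using C_cnj[of 0 0] C0[of 0] by (simp add: complex_eq_iff)
    define A' where "A' = mat m m (\<lambda>(i, j). C $$ (Suc i, Suc j))"
    have A': "A' \<in> carrier_mat m m" unfolding A'_def by simp
    have "hermitian A'"
      unfolding hermitian_iff_index[OF A']
    proof (intro allI impI)
      fix i j assume "i < m" "j < m"
      then show "A' $$ (i, j) = cnj (A' $$ (j, i))"
        using C_cnj[of "Suc i" "Suc j"] by (simp add: A'_def)
    qed
    from Suc.IH[OF A' this] obtain V d where V: "unitary m V"
      and A'_eq: "A' = V * mat_diag m (\<lambda>i. complex_of_real (d i)) * mat_adjoint V" by blast
    have Vc: "V \<in> carrier_mat m m" and VV: "mat_adjoint V * V = 1\<^sub>m m"
      using V by (auto simp: unitary_def)
    note Vc' = mat_adjoint_carrier[OF Vc]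
    define E where "E = mat_diag 1 (\<lambda>i. complex_of_real (Re e))"
    have E: "E \<in> carrier_mat 1 1" unfolding E_def by simp
    define V1 where "V1 = four_block_mat (1\<^sub>m 1) (0\<^sub>m 1 m) (0\<^sub>m m 1) V"
    define d1 where "d1 = (\<lambda>i. case i of 0 \<Rightarrow> Re e | Suc j \<Rightarrow> d j)"
    let ?D1 = "mat_diag ?n (\<lambda>i. complex_of_real (d1 i))"
    have V1: "V1 \<in> carrier_mat ?n ?n" 
      unfolding V1_def using four_block_carrier_mat[of "1\<^sub>m 1" 1 1 V m m] Vc by simp
    have one_adj: "mat_adjoint (1\<^sub>m 1) = (1\<^sub>m 1 :: complex mat)" by (rule eq_matI) auto
    have V1_adj: "mat_adjoint V1 = four_block_mat (1\<^sub>m 1) (0\<^sub>m 1 m) (0\<^sub>m m 1) (mat_adjoint V)"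
      unfolding V1_def mat_adjoint_four_block_diag[OF one_carrier_mat Vc] one_adj ..
    have "mat_adjoint V1 * V1 = four_block_mat (1\<^sub>m 1) (0\<^sub>m 1 m) (0\<^sub>m m 1) (1\<^sub>m m)"
      unfolding V1_adj unfolding V1_def
        mult_four_block_diag[OF one_carrier_mat Vc' one_carrier_mat Vc] VV by simp
    also have "\<dots> = 1\<^sub>m ?n" by (rule eq_matI) auto
    finally have uV1: "unitary ?n V1" by (rule unitaryI[OF V1])
    have "?D1 = four_block_mat E (0\<^sub>m 1 m) (0\<^sub>m m 1) (mat_diag m (\<lambda>i. complex_of_real (d i)))"
      unfolding E_def d1_def
      by (rule eq_matI) (auto simp: mat_diag_def split: nat.splits)
    then have "V1 * ?D1 * mat_adjoint V1 = four_block_mat (1\<^sub>m 1 * E * 1\<^sub>m 1) (0\<^sub>m 1 m) (0\<^sub>m m 1) A'"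
      unfolding V1_adj A'_eq unfolding V1_def
      using mult_four_block_diag[OF one_carrier_mat Vc E mat_diag_dim]
        mult_four_block_diag[OF mult_carrier_mat[OF one_carrier_mat E]
          mult_carrier_mat[OF Vc mat_diag_dim] one_carrier_mat Vc']
      by metis
    also have "1\<^sub>m 1 * E * 1\<^sub>m 1 = E" using E by simp
    also have "four_block_mat E (0\<^sub>m 1 m) (0\<^sub>m m 1) A' = C"
    proof (rule eq_matI)
      fix i j assume "i < dim_row C" "j < dim_col C"
      then have ij: "i < ?n" "j < ?n" using C by auto
      then show "four_block_mat E (0\<^sub>m 1 m) (0\<^sub>m m 1) A' $$ (i, j) = C $$ (i, j)"
        using C0[of i] C0[of j] C_cnj[of 0 j] e_real A' E
        by (cases i; cases j) (auto simp: A'_def E_def mat_diag_def)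
    qed (use A' C E in auto)
    finally have C_eq: "C = V1 * ?D1 * mat_adjoint V1" by simp
    have "A = W * C * mat_adjoint W"
    proof -
      have "W * C * mat_adjoint W = (W * mat_adjoint W) * A * (W * mat_adjoint W)"
        unfolding C_def using Wc Wc' A by (simp add: assoc carr)
      then show ?thesis using A by (simp add: WW)
    qed
    also have "\<dots> = (W * V1) * ?D1 * mat_adjoint (W * V1)"
      unfolding C_eq using Wc Wc' V1 mat_adjoint_carrier[OF V1]
      by (simp add: mat_adjoint_mult[OF Wc V1] assoc carr)
    finally show ?case using unitary_mult[OF W uV1] by blast
  qed
  then show thesis using that by blast
qed

section \<open>Positive semidefinite square roots\<close>

lemma mult_mat_vec_cscalar_prod:
  assumes "(A :: complex mat) \<in> carrier_mat m n" "x \<in> carrier_vec n" "y \<in> carrier_vec m"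
  shows "(A *\<^sub>v x) \<bullet>c y = x \<bullet>c (mat_adjoint A *\<^sub>v y)"
proof -
  have "(A *\<^sub>v x) \<bullet>c y = (\<Sum>i<m. \<Sum>j<n. A $$ (i, j) * x $ j * cnj (y $ i))"
    using assms by (simp add: scalar_prod_def atLeast0LessThan sum_distrib_right)
  also have "\<dots> = (\<Sum>j<n. \<Sum>i<m. x $ j * (A $$ (i, j) * cnj (y $ i)))"
    by (subst sum.swap) (simp add: ac_simps)
  also have "\<dots> = x \<bullet>c (mat_adjoint A *\<^sub>v y)"
    using assms by (simp add: scalar_prod_def atLeast0LessThan sum_distrib_left)
  finally show ?thesis .
qed

lemma positive_semidefinite_conj:
  assumes B: "B \<in> carrier_mat n n" "positive_semidefinite B" and U: "U \<in> carrier_mat n n"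
  shows "positive_semidefinite (mat_adjoint U * B * U)"
proof -
  note U' = mat_adjoint_carrier[OF U]
  note assoc = assoc_mult_mat[of _ n n _ n _ n]
  have "mat_adjoint (mat_adjoint U * B * U) = mat_adjoint U * B * U"
    using B U mult_carrier_mat[OF U' B(1)]
    by (simp add: positive_semidefinite_def hermitian_def mat_adjoint_mult[of _ n n _ n] assoc
        mult_carrier_mat[of _ n n _ n])
  moreover have "Re (((mat_adjoint U * B * U) *\<^sub>v v) \<bullet>c v) \<ge> 0" if v: "v \<in> carrier_vec n" for v
  proof -
    have Uv: "U *\<^sub>v v \<in> carrier_vec n" using U v by simp
    have "(mat_adjoint U * B * U) *\<^sub>v v = mat_adjoint U *\<^sub>v (B *\<^sub>v (U *\<^sub>v v))"
      using assoc_mult_mat_vec[OF mult_carrier_mat[OF U' B(1)] U v]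
        assoc_mult_mat_vec[OF U' B(1) Uv] by simp
    then have "((mat_adjoint U * B * U) *\<^sub>v v) \<bullet>c v = (B *\<^sub>v (U *\<^sub>v v)) \<bullet>c (U *\<^sub>v v)"
      using mult_mat_vec_cscalar_prod[OF U' mult_mat_vec_carrier[OF B(1) Uv] v] by simp
    then show ?thesis
      using B Uv by (auto simp: positive_semidefinite_def)
  qed
  ultimately show ?thesis
    using U by (auto simp: positive_semidefinite_def hermitian_def)
qed

lemma positive_semidefinite_mat_diag:
  assumes "\<And>i. i < n \<Longrightarrow> 0 \<le> d i"
  shows "positive_semidefinite (mat_diag n (\<lambda>i. complex_of_real (d i)))"
proof -
  let ?D = "mat_diag n (\<lambda>i. complex_of_real (d i))"
  have "Re ((?D *\<^sub>v v) \<bullet>c v) \<ge> 0" if v: "v \<in> carrier_vec n" for v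
  proof -
    have "(?D *\<^sub>v v) $ i = d i * v $ i" if "i < n" for i
      using that v by (simp add: mat_diag_def scalar_prod_def atLeast0LessThan
          if_distrib[where f = "\<lambda>z. z * _"] cong: if_cong)
    moreover have "dim_vec (?D *\<^sub>v v) = n" by (simp add: mat_diag_def)
    ultimately have "(?D *\<^sub>v v) \<bullet>c v = (\<Sum>i<n. complex_of_real (d i * (cmod (v $ i))\<^sup>2))"
      using v by (simp add: scalar_prod_def atLeast0LessThan complex_norm_square mult.assoc
          del: of_real_power)
    then show ?thesis
      using assms by (auto intro!: sum_nonneg)
  qed
  then show ?thesis
    by (simp add: positive_semidefinite_def hermitian_def mat_diag_def[THEN arg_cong[where f = dim_row]])
qed

lemma positive_semidefinite_diag_nonneg:
  assumes B: "B \<in> carrier_mat n n" "positive_semidefinite B" and i: "i < n"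
  shows "0 \<le> B $$ (i, i)"
proof -
  have "conjugate (unit_vec n i :: complex vec) = unit_vec n i"
    by (rule eq_vecI) (auto simp: unit_vec_def)
  then have "(B *\<^sub>v unit_vec n i) \<bullet>c unit_vec n i = B $$ (i, i)"
    using B i by simp
  then have "Re (B $$ (i, i)) \<ge> 0"
    using B i by (metis carrier_matD(1) positive_semidefinite_def unit_vec_carrier)
  moreover have "Im (B $$ (i, i)) = 0"
  proof -
    have "hermitian B" using B by (simp add: positive_semidefinite_def)
    then have "B $$ (i, i) = cnj (B $$ (i, i))"
      using hermitian_iff_index[OF B(1)] i by blast
    then show ?thesis by (simp add: complex_eq_iff)
  qed
  ultimately show ?thesis by (simp add: less_eq_complex_def)
qed

text \<open>Conjugate everything by a unitary that diagonalises \<open>B - Q\<close>. The two conjugates then have the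
  same off-diagonal entries, so comparing diagonal entries of their equal squares leaves
  \<open>b\<^sup>2 = q\<^sup>2\<close> for corresponding diagonal entries \<open>b\<close> and \<open>q\<close>. Both are nonnegative, so \<open>b = q\<close>.\<close>

lemma positive_semidefinite_sqrt_unique:
  assumes B: "B \<in> carrier_mat n n" "positive_semidefinite B"
    and Q: "Q \<in> carrier_mat n n" "positive_semidefinite Q"
    and sq: "B * B = Q * Q"
  shows "B = Q"
proof -
  have "mat_adjoint (B - Q) = mat_adjoint B - mat_adjoint Q"
    using B(1) Q(1) by (intro eq_matI) auto
  then have "hermitian (B - Q)"
    using B(2) Q(2) by (simp add: positive_semidefinite_def hermitian_def)
  then obtain U d where U: "unitary n U"
    and S: "B - Q = U * mat_diag n (\<lambda>i. complex_of_real (d i)) * mat_adjoint U"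
    using hermitian_spectral_decomposition[of "B - Q" n] minus_carrier_mat[OF Q(1)] by blast
  let ?D = "mat_diag n (\<lambda>i. complex_of_real (d i))"
  have Uc: "U \<in> carrier_mat n n" and UU: "mat_adjoint U * U = 1\<^sub>m n" "U * mat_adjoint U = 1\<^sub>m n"
    using U by (auto simp: unitary_def)
  note Uc' = mat_adjoint_carrier[OF Uc]
  note assoc = assoc_mult_mat[of _ n n _ n _ n]
  note carr = mult_carrier_mat[of _ n n _ n]
  define conj where "conj X = mat_adjoint U * X * U" for X
  have conj_carrier: "conj X \<in> carrier_mat n n" if "X \<in> carrier_mat n n" for X
    unfolding conj_def using that Uc by (simp add: carr)
  have conj_sq: "conj X * conj X = conj (X * X)" if X: "X \<in> carrier_mat n n" for X
  proof -
    have "conj X * conj X = mat_adjoint U * X * (U * mat_adjoint U) * (X * U)"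
      unfolding conj_def using X Uc by (simp add: assoc carr del: UU)
    then show ?thesis unfolding conj_def using X Uc by (simp add: UU assoc carr)
  qed
  have diff: "conj B $$ (i, j) - conj Q $$ (i, j) = ?D $$ (i, j)" if ij: "i < n" "j < n" for i j
  proof -
    have "conj (B - Q) = conj B - conj Q"
      unfolding conj_def using B Q Uc
      by (simp add: mult_minus_distrib_mat[OF Uc' B(1) Q(1)]
          minus_mult_distrib_mat[OF mult_carrier_mat[OF Uc' B(1)] mult_carrier_mat[OF Uc' Q(1)] Uc])
    moreover have "conj (B - Q) = (mat_adjoint U * U) * ?D * (mat_adjoint U * U)"
      unfolding conj_def S using Uc by (simp add: assoc carr)
    ultimately have "conj B - conj Q = ?D"
      by (simp add: UU left_mult_one_mat[OF mat_diag_dim] right_mult_one_mat[OF mat_diag_dim])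
    then have "(conj B - conj Q) $$ (i, j) = ?D $$ (i, j)" by simp
    then show ?thesis using conj_carrier[OF B(1)] conj_carrier[OF Q(1)] ij by simp
  qed
  have "d j = 0" if j: "j < n" for j
  proof -
    let ?b = "conj B $$ (j, j)" and ?q = "conj Q $$ (j, j)"
    have sq_index: "(conj X * conj X) $$ (j, j)
        = conj X $$ (j, j) * conj X $$ (j, j) + (\<Sum>l\<in>{..<n} - {j}. conj X $$ (j, l) * conj X $$ (l, j))"
      if "X \<in> carrier_mat n n" for X
      using conj_carrier[OF that] j
      by (simp add: scalar_prod_def atLeast0LessThan sum.remove[of "{..<n}" j])
    have "conj B $$ (i, l) = conj Q $$ (i, l)" if "i < n" "l < n" "i \<noteq> l" for i l
      using diff[OF that(1,2)] that by (simp add: mat_diag_def)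
    then have "(\<Sum>l\<in>{..<n} - {j}. conj B $$ (j, l) * conj B $$ (l, j))
        = (\<Sum>l\<in>{..<n} - {j}. conj Q $$ (j, l) * conj Q $$ (l, j))"
      using j by (intro sum.cong) auto
    then have "?b * ?b = ?q * ?q"
      using sq_index[OF B(1)] sq_index[OF Q(1)] conj_sq[OF B(1)] conj_sq[OF Q(1)] sq by simp
    moreover have "0 \<le> ?b" "0 \<le> ?q"
      using positive_semidefinite_diag_nonneg[OF conj_carrier _ j] positive_semidefinite_conj B Q Uc
      unfolding conj_def by blast+
    ultimately have "?b = ?q"
      by (auto simp: less_eq_complex_def complex_eq_iff square_eq_iff)
    then show ?thesis using diff[OF j j] j by (simp add: mat_diag_def)
  qed
  then have "?D = 0\<^sub>m n n" by (intro eq_matI) (auto simp: mat_diag_def)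
  then have "B - Q = 0\<^sub>m n n" unfolding S using Uc Uc' by simp
  then have "(B - Q) $$ (i, j) = 0" if "i < n" "j < n" for i j using that by simp
  then show ?thesis using B Q by (intro eq_matI) auto
qed

lemma psd_sqrt_eqI:
  assumes "Q \<in> carrier_mat n n" "positive_semidefinite Q" "Q * Q = A"
  shows "psd_sqrt A = Q"
  unfolding psd_sqrt_def
proof (rule the_equality)
  fix B assume B: "positive_semidefinite B \<and> B * B = A"
  have "dim_row B = dim_col B"
    using B unfolding positive_semidefinite_def hermitian_def by (metis dim_mat_adjoint(1))
  moreover have "dim_row B = n" using B assms by (metis carrier_matD(1) index_mult_mat(2))
  ultimately have "B \<in> carrier_mat n n" by auto
  then show "B = Q" using positive_semidefinite_sqrt_unique B assms by blast
qed (use assms in simp)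

section \<open>The trace norm of a Hermitian matrix\<close>

lemma spectral_index:
  assumes U: "U \<in> carrier_mat n n" and "a < n" "b < n"
  shows "(U * mat_diag n f * mat_adjoint U) $$ (a, b) = (\<Sum>m<n. U $$ (a, m) * f m * cnj (U $$ (b, m)))"
  using assms by (simp add: mat_diag_mult_right[OF U] scalar_prod_def atLeast0LessThan)

text \<open>Replacing the eigenvalues of \<open>X\<close> by their absolute values gives a positive semidefinite matrix
  with the same square as \<open>X\<close>, so it is the absolute value of \<open>X\<close>.\<close>

lemma trace_norm_spectral:
  assumes U: "unitary n U"
    and X: "X = U * mat_diag n (\<lambda>i. complex_of_real (d i)) * mat_adjoint U"
  shows "trace_norm X = (\<Sum>i<n. \<bar>d i\<bar>)"
proof -
  have Uc: "U \<in> carrier_mat n n" and UU: "mat_adjoint U * U = 1\<^sub>m n"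
    using U by (auto simp: unitary_def)
  note Uc' = mat_adjoint_carrier[OF Uc]
  note assoc = assoc_mult_mat[of _ n n _ n _ n]
  note carr = mult_carrier_mat[of _ n n _ n]
  let ?D = "\<lambda>d. mat_diag n (\<lambda>i. complex_of_real (d i))"
  let ?A = "U * ?D (\<lambda>i. \<bar>d i\<bar>) * mat_adjoint U"
  have mult: "(U * ?D e * mat_adjoint U) * (U * ?D e * mat_adjoint U)
      = U * ?D (\<lambda>i. e i * e i) * mat_adjoint U" for e
  proof -
    have "(U * ?D e * mat_adjoint U) * (U * ?D e * mat_adjoint U)
        = U * ?D e * (mat_adjoint U * U) * (?D e * mat_adjoint U)"
      using Uc by (simp add: assoc carr)
    also have "\<dots> = U * (?D e * ?D e) * mat_adjoint U"
      unfolding UU using Uc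
      by (simp add: assoc carr left_mult_one_mat[of _ n n] del: mat_diag_diag)
    finally show ?thesis by simp
  qed
  have "mat_adjoint X = X"
    unfolding X using Uc
    by (simp add: mat_adjoint_mult[of _ n n _ n] assoc carr)
  then have "?A * ?A = mat_adjoint X * X"
    using mult[of "\<lambda>i. \<bar>d i\<bar>"] mult[of d] by (simp add: X)
  moreover have "positive_semidefinite ?A"
    using positive_semidefinite_conj[OF mat_diag_dim positive_semidefinite_mat_diag Uc',
        of "\<lambda>i. \<bar>d i\<bar>"] by simp
  moreover have A: "?A \<in> carrier_mat n n" using Uc by (simp add: carr)
  ultimately have "mat_abs X = ?A"
    unfolding mat_abs_def by (intro psd_sqrt_eqI) auto
  then have "mat_trace (mat_abs X) = (\<Sum>a<n. \<Sum>m<n. U $$ (a, m) * \<bar>d m\<bar> * cnj (U $$ (a, m)))"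
    by (simp add: mat_trace_def carrier_matD(1)[OF A] spectral_index[OF Uc] del: index_mult_mat)
  also have "\<dots> = (\<Sum>m<n. \<bar>d m\<bar> * (\<Sum>a<n. cnj (U $$ (a, m)) * U $$ (a, m)))"
    by (subst sum.swap) (simp add: sum_distrib_left ac_simps)
  also have "\<dots> = (\<Sum>m<n. complex_of_real \<bar>d m\<bar>)"
    using unitary_cols_orthonormal[OF U] by (intro sum.cong) auto
  finally show ?thesis by (simp add: trace_norm_def)
qed

lemma spectral_eigenvalue:
  assumes U: "unitary n U" and X: "X = U * mat_diag n f * mat_adjoint U" and m: "m < n"
  shows "f m = (\<Sum>a<n. \<Sum>b<n. cnj (U $$ (a, m)) * X $$ (a, b) * U $$ (b, m))"
proof -
  have Uc: "U \<in> carrier_mat n n" and UU: "mat_adjoint U * U = 1\<^sub>m n"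
    using U by (auto simp: unitary_def)
  note Uc' = mat_adjoint_carrier[OF Uc]
  note assoc = assoc_mult_mat[of _ n n _ n _ n]
  note carr = mult_carrier_mat[of _ n n _ n]
  have Xc: "X \<in> carrier_mat n n" unfolding X using Uc by (simp add: carr)
  have "mat_adjoint U * (X * U) = (mat_adjoint U * U) * mat_diag n f * (mat_adjoint U * U)"
    unfolding X using Uc by (simp add: assoc carr)
  then have "mat_adjoint U * (X * U) = mat_diag n f"
    by (simp add: UU left_mult_one_mat[OF mat_diag_dim] right_mult_one_mat[OF mat_diag_dim])
  then have "f m = (mat_adjoint U * (X * U)) $$ (m, m)" using m by (simp add: mat_diag_def)
  also have "\<dots> = (\<Sum>a<n. \<Sum>b<n. cnj (U $$ (a, m)) * X $$ (a, b) * U $$ (b, m))"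
    using Uc Xc m by (simp add: scalar_prod_def atLeast0LessThan sum_distrib_left mult.assoc)
  finally show ?thesis .
qed

section \<open>Block matrices and commutators\<close>

lemma sum_blocks:
  fixes f :: "nat \<Rightarrow> 'a :: comm_monoid_add"
  shows "(\<Sum>a<k * n. f a) = (\<Sum>i<k. \<Sum>p<n. f (i * n + p))"
proof -
  have "(\<Sum>a<k * n. f a) = (\<Sum>i<k. sum f {i * n..<i * n + n})" by (simp add: sum.nat_group)
  then show ?thesis by (simp add: sum.atLeastLessThan_shift_0[of f] atLeast0LessThan)
qed

lemma block_index_less:
  assumes "i < k" "p < (n :: nat)"
  shows "i * n + p < k * n"
proof -
  have "i * n + p < Suc i * n" using assms by simp
  also have "\<dots> \<le> k * n" using assms by (intro mult_le_mono1) simp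
  finally show ?thesis .
qed

lemma block_mat_carrier [simp]: "block_mat k n B \<in> carrier_mat (k * n) (k * n)"
  by (simp add: block_mat_def)

lemma index_block_mat:
  assumes "i < k" "j < k" "p < n" "q < n"
  shows "block_mat k n B $$ (i * n + p, j * n + q) = B i j $$ (p, q)"
  using assms block_index_less[of i k p n] block_index_less[of j k q n] by (simp add: block_mat_def)

lemma hermitian_block_mat:
  assumes "\<And>i j. i < k \<Longrightarrow> j < k \<Longrightarrow> B i j \<in> carrier_mat n n"
    and "\<And>i j. i < k \<Longrightarrow> j < k \<Longrightarrow> mat_adjoint (B i j) = B j i"
  shows "hermitian (block_mat k n B)"
  unfolding hermitian_iff_index[OF block_mat_carrier]
proof (intro allI impI)
  fix a b assume ab: "a < k * n" "b < k * n"
  then have n: "n > 0" by (cases n) auto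
  have div: "a div n < k" "b div n < k"
    using ab by (simp_all add: less_mult_imp_div_less)
  have "mat_adjoint (B (b div n) (a div n)) $$ (a mod n, b mod n)
      = cnj (B (b div n) (a div n) $$ (b mod n, a mod n))"
    using assms(1)[OF div(2,1)] n by simp
  then show "block_mat k n B $$ (a, b) = cnj (block_mat k n B $$ (b, a))"
    using ab by (simp add: block_mat_def assms(2)[OF div(2,1)])
qed

lemma commutator_carrier:
  assumes "X \<in> carrier_mat n n" "Y \<in> carrier_mat n n"
  shows "commutator X Y \<in> carrier_mat n n"
  using assms unfolding commutator_def by (intro minus_carrier_mat mult_carrier_mat)

lemma mat_adjoint_commutator:
  assumes X: "X \<in> carrier_mat n n" "hermitian X" and Y: "Y \<in> carrier_mat n n" "hermitian Y"
  shows "mat_adjoint (commutator X Y) = commutator Y X"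
proof -
  have "mat_adjoint (X * Y - Y * X) = mat_adjoint (X * Y) - mat_adjoint (Y * X)"
    using X(1) Y(1) by (intro eq_matI) auto
  then show ?thesis
    using X Y by (simp add: commutator_def hermitian_def mat_adjoint_mult[of _ n n _ n])
qed

section \<open>Bounding the eigenvalues of the commutator block matrix\<close>

text \<open>The rows of a unitary matrix are orthonormal, so a combination of the distinct rows \<open>g q\<close> has the
  norm of its coefficient vector. Read column by column, this is the frame property of a family
  of blocks of an orthonormal basis.\<close>

lemma unitary_rows_parseval:
  fixes n :: nat
  assumes U: "unitary N U" and g: "inj_on g {..<n}" "\<And>q. q < n \<Longrightarrow> g q < N"
  shows "(\<Sum>m<N. (cmod (\<Sum>q<n. c q * U $$ (g q, m)))\<^sup>2) = (\<Sum>q<n. (cmod (c q))\<^sup>2)"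
proof -
  have "complex_of_real (\<Sum>m<N. (cmod (\<Sum>q<n. c q * U $$ (g q, m)))\<^sup>2)
      = (\<Sum>m<N. \<Sum>q<n. \<Sum>s<n. c q * cnj (c s) * (U $$ (g q, m) * cnj (U $$ (g s, m))))"
    by (simp add: complex_norm_square sum_product ac_simps del: of_real_power)
  also have "\<dots> = (\<Sum>q<n. \<Sum>m<N. \<Sum>s<n. c q * cnj (c s) * (U $$ (g q, m) * cnj (U $$ (g s, m))))"
    by (rule sum.swap)
  also have "\<dots> = (\<Sum>q<n. \<Sum>s<n. \<Sum>m<N. c q * cnj (c s) * (U $$ (g q, m) * cnj (U $$ (g s, m))))"
    by (rule sum.cong[OF refl], rule sum.swap)
  also have "\<dots> = (\<Sum>q<n. \<Sum>s<n. c q * cnj (c s) * (\<Sum>m<N. U $$ (g q, m) * cnj (U $$ (g s, m))))"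
    by (simp add: sum_distrib_left)
  also have "\<dots> = (\<Sum>q<n. \<Sum>s<n. if s = q then c q * cnj (c s) else 0)"
    using g by (intro sum.cong refl) (auto simp: unitary_rows_orthonormal[OF U] inj_on_def)
  also have "\<dots> = (\<Sum>q<n. c q * cnj (c q))"
    by (intro sum.cong refl) simp
  also have "\<dots> = complex_of_real (\<Sum>q<n. (cmod (c q))\<^sup>2)"
    by (simp add: complex_norm_square del: of_real_power)
  finally show ?thesis by (simp only: of_real_eq_iff)
qed

definition frobenius_norm_sq :: "complex mat \<Rightarrow> real" where
  "frobenius_norm_sq A = (\<Sum>r<dim_row A. \<Sum>c<dim_col A. (cmod (A $$ (r, c)))\<^sup>2)"

text \<open>This is \<open>\<langle>A B y, x\<rangle> = \<langle>B y, A x\<rangle>\<close> in coordinates. Coordinate functions are used because \<open>x\<close> and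
  \<open>y\<close> will be blocks of a column of a larger matrix.\<close>

lemma sesquilinear_form_hermitian_prod:
  assumes A: "A \<in> carrier_mat n n" "hermitian A" and B: "B \<in> carrier_mat n n"
  shows "(\<Sum>p<n. \<Sum>q<n. cnj (x p) * (A * B) $$ (p, q) * y q)
    = (\<Sum>r<n. cnj (\<Sum>p<n. A $$ (r, p) * x p) * (\<Sum>q<n. B $$ (r, q) * y q))"
proof -
  have "(\<Sum>p<n. \<Sum>q<n. cnj (x p) * (A * B) $$ (p, q) * y q)
      = (\<Sum>p<n. \<Sum>q<n. \<Sum>r<n. cnj (x p) * A $$ (p, r) * (B $$ (r, q) * y q))"
    using A(1) B
    by (simp add: scalar_prod_def atLeast0LessThan sum_distrib_left sum_distrib_right mult.assoc)
  also have "\<dots> = (\<Sum>p<n. \<Sum>r<n. \<Sum>q<n. cnj (x p) * A $$ (p, r) * (B $$ (r, q) * y q))"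
    by (rule sum.cong[OF refl], rule sum.swap)
  also have "\<dots> = (\<Sum>r<n. \<Sum>p<n. \<Sum>q<n. cnj (x p) * A $$ (p, r) * (B $$ (r, q) * y q))"
    by (rule sum.swap)
  also have "\<dots> = (\<Sum>r<n. (\<Sum>p<n. cnj (x p) * A $$ (p, r)) * (\<Sum>q<n. B $$ (r, q) * y q))"
    by (simp add: sum_product)
  also have "\<dots> = (\<Sum>r<n. cnj (\<Sum>p<n. A $$ (r, p) * x p) * (\<Sum>q<n. B $$ (r, q) * y q))"
  proof (intro sum.cong refl arg_cong2[where f = "(*)"])
    fix r assume "r \<in> {..<n}"
    then have "cnj (A $$ (r, p)) = A $$ (p, r)" if "p < n" for p
      using A(2)[unfolded hermitian_iff_index[OF A(1)], rule_format, of p r] that by simp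
    then show "(\<Sum>p<n. cnj (x p) * A $$ (p, r)) = cnj (\<Sum>p<n. A $$ (r, p) * x p)"
      by (simp add: mult.commute)
  qed
  finally show ?thesis .
qed

lemma cmod_sum_cnj_mult_le:
  "2 * cmod (\<Sum>r\<in>R. cnj (a r) * b r) \<le> (\<Sum>r\<in>R. (cmod (a r))\<^sup>2) + (\<Sum>r\<in>R. (cmod (b r))\<^sup>2)"
proof -
  have "2 * cmod (\<Sum>r\<in>R. cnj (a r) * b r) \<le> (\<Sum>r\<in>R. 2 * (cmod (a r) * cmod (b r)))"
    using sum_norm_le[of R "\<lambda>r. cnj (a r) * b r" "\<lambda>r. cmod (a r) * cmod (b r)"]
    by (simp add: norm_mult flip: sum_distrib_left)
  also have "\<dots> \<le> (\<Sum>r\<in>R. (cmod (a r))\<^sup>2 + (cmod (b r))\<^sup>2)"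
    using sum_squares_bound by (intro sum_mono) (simp add: mult.assoc)
  finally show ?thesis by (simp add: sum.distrib)
qed

text \<open>The two products \<open>A B\<close> and \<open>B A\<close> are estimated separately: each becomes an inner product of two
  vectors by hermiticity, to which \<open>2 \<bar>\<langle>a, b\<rangle>\<bar> \<le> \<parallel>a\<parallel>\<^sup>2 + \<parallel>b\<parallel>\<^sup>2\<close> applies.\<close>

lemma commutator_form_bound:
  assumes A: "A \<in> carrier_mat n n" "hermitian A" and B: "B \<in> carrier_mat n n" "hermitian B"
  defines "S \<equiv> \<lambda>M z. \<Sum>r<n. (cmod (\<Sum>p<n. M $$ (r, p) * z p))\<^sup>2"
  shows "2 * cmod (\<Sum>p<n. \<Sum>q<n. cnj (x p) * commutator A B $$ (p, q) * y q)
    \<le> S A x + S B y + S B x + S A y"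
proof -
  let ?f = "\<lambda>A B. \<Sum>p<n. \<Sum>q<n. cnj (x p) * (A * B) $$ (p, q) * y q"
  have "(\<Sum>p<n. \<Sum>q<n. cnj (x p) * commutator A B $$ (p, q) * y q) = ?f A B - ?f B A"
    using A(1) B(1)
    by (simp add: commutator_def algebra_simps del: index_mult_mat(1) flip: sum_subtractf)
  moreover have "2 * cmod (?f A B) \<le> S A x + S B y"
    unfolding sesquilinear_form_hermitian_prod[OF A B(1)] S_def by (rule cmod_sum_cnj_mult_le)
  moreover have "2 * cmod (?f B A) \<le> S B x + S A y"
    unfolding sesquilinear_form_hermitian_prod[OF B A(1)] S_def by (rule cmod_sum_cnj_mult_le)
  ultimately show ?thesis
    using norm_triangle_ineq4[of "?f A B" "?f B A"] by simp
qed

lemma sum_off_diagonal_pairs: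
  fixes F :: "nat \<Rightarrow> real"
  shows "(\<Sum>i<k. \<Sum>j\<in>{..<k} - {i}. F i + F j) = 2 * (real k - 1) * (\<Sum>i<k. F i)"
proof -
  have "(\<Sum>i<k. \<Sum>j\<in>{..<k} - {i}. F i + F j) = (\<Sum>i<k. (\<Sum>j<k. F i + F j) - 2 * F i)"
  proof (rule sum.cong[OF refl])
    fix i assume "i \<in> {..<k}"
    then show "(\<Sum>j\<in>{..<k} - {i}. F i + F j) = (\<Sum>j<k. F i + F j) - 2 * F i"
      using sum.remove[of "{..<k}" i "\<lambda>j. F i + F j"] by simp
  qed
  also have "\<dots> = 2 * (real k - 1) * (\<Sum>i<k. F i)"
    by (simp add: sum.distrib sum_subtractf algebra_simps flip: sum_distrib_left sum_distrib_right)
  finally show ?thesis .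
qed

text \<open>In the proof, \<open>x m i\<close> is the \<open>i\<close>-th block of the \<open>m\<close>-th eigenvector and \<open>S m i j\<close> is the squared
  norm of \<open>H i\<close> applied to \<open>x m j\<close>. Summing over \<open>m\<close> removes the dependence on the second index, after
  which the four terms of the bound pair up.\<close>

theorem trace_norm_commutator_block_mat_le:
  assumes H: "\<And>i. i < k \<Longrightarrow> H i \<in> carrier_mat n n" "\<And>i. i < k \<Longrightarrow> hermitian (H i)"
  shows "trace_norm (block_mat k n (\<lambda>i j. commutator (H i) (H j)))
    \<le> 2 * (real k - 1) * (\<Sum>i<k. frobenius_norm_sq (H i))"
proof -
  let ?C = "\<lambda>i j. commutator (H i) (H j)"
  let ?N = "k * n"
  let ?X = "block_mat k n ?C"
  have "hermitian ?X"
    using H by (intro hermitian_block_mat) (auto intro: commutator_carrier mat_adjoint_commutator)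
  then obtain U d where U: "unitary ?N U"
    and X: "?X = U * mat_diag ?N (\<lambda>i. complex_of_real (d i)) * mat_adjoint U"
    using hermitian_spectral_decomposition[OF block_mat_carrier] by blast
  define x where "x m i p = U $$ (i * n + p, m)" for m i p
  define S where "S m i j = (\<Sum>r<n. (cmod (\<Sum>p<n. H i $$ (r, p) * x m j p))\<^sup>2)" for m i j
  have frob: "(\<Sum>m<?N. S m i j) = frobenius_norm_sq (H i)" if ij: "i < k" "j < k" for i j
  proof -
    have "(\<Sum>m<?N. S m i j) = (\<Sum>r<n. \<Sum>m<?N. (cmod (\<Sum>p<n. H i $$ (r, p) * U $$ (j * n + p, m)))\<^sup>2)"
      unfolding S_def x_def by (rule sum.swap)
    also have "\<dots> = (\<Sum>r<n. \<Sum>p<n. (cmod (H i $$ (r, p)))\<^sup>2)"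
      using block_index_less[OF ij(2)]
      by (intro sum.cong refl unitary_rows_parseval[OF U]) (auto simp: inj_on_def)
    finally show ?thesis using H(1)[OF ij(1)] by (simp add: frobenius_norm_sq_def)
  qed
  have eigenvalue_bound:
    "2 * \<bar>d m\<bar> \<le> (\<Sum>i<k. \<Sum>j\<in>{..<k} - {i}. S m i i + S m j j + S m j i + S m i j)"
    if m: "m < ?N" for m
  proof -
    let ?f = "\<lambda>i j. \<Sum>p<n. \<Sum>q<n. cnj (x m i p) * ?C i j $$ (p, q) * x m j q"
    have "complex_of_real (d m) = (\<Sum>a<?N. \<Sum>b<?N. cnj (U $$ (a, m)) * ?X $$ (a, b) * U $$ (b, m))"
      by (rule spectral_eigenvalue[OF U X m])
    also have "\<dots> = (\<Sum>i<k. \<Sum>p<n. \<Sum>j<k. \<Sum>q<n. cnj (x m i p) * ?C i j $$ (p, q) * x m j q)"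
      unfolding sum_blocks x_def by (intro sum.cong refl) (simp add: index_block_mat)
    also have "\<dots> = (\<Sum>i<k. \<Sum>j<k. ?f i j)"
      by (rule sum.cong[OF refl], rule sum.swap)
    also have "\<dots> = (\<Sum>i<k. \<Sum>j\<in>{..<k} - {i}. ?f i j)"
    proof (rule sum.cong[OF refl])
      fix i assume i: "i \<in> {..<k}"
      \<comment> \<open>Dropping the diagonal blocks is what turns the factor \<open>k\<close> into \<open>k - 1\<close>.\<close>
      have "?f i i = 0"
        using H(1)[of i] i by (simp add: commutator_def del: index_mult_mat(1))
      then show "(\<Sum>j<k. ?f i j) = (\<Sum>j\<in>{..<k} - {i}. ?f i j)"
        using i by (simp add: sum.remove[of "{..<k}" i])
    qed
    finally have "cmod (complex_of_real (d m)) \<le> (\<Sum>i<k. \<Sum>j\<in>{..<k} - {i}. cmod (?f i j))"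
      by (simp only:) (intro sum_norm_le order_refl)
    then have "2 * \<bar>d m\<bar> \<le> (\<Sum>i<k. \<Sum>j\<in>{..<k} - {i}. 2 * cmod (?f i j))"
      by (simp flip: sum_distrib_left)
    also have "\<dots> \<le> (\<Sum>i<k. \<Sum>j\<in>{..<k} - {i}. S m i i + S m j j + S m j i + S m i j)"
      unfolding S_def by (intro sum_mono commutator_form_bound) (auto simp: H)
    finally show ?thesis .
  qed
  have "2 * trace_norm ?X = (\<Sum>m<?N. 2 * \<bar>d m\<bar>)"
    by (simp add: trace_norm_spectral[OF U X] sum_distrib_left)
  also have "\<dots> \<le> (\<Sum>m<?N. \<Sum>i<k. \<Sum>j\<in>{..<k} - {i}. S m i i + S m j j + S m j i + S m i j)"
    using eigenvalue_bound by (intro sum_mono) simp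
  also have "\<dots> = (\<Sum>i<k. \<Sum>j\<in>{..<k} - {i}. \<Sum>m<?N. S m i i + S m j j + S m j i + S m i j)"
    by (subst sum.swap, rule sum.cong[OF refl], rule sum.swap)
  also have "\<dots> = (\<Sum>i<k. \<Sum>j\<in>{..<k} - {i}. 2 * (frobenius_norm_sq (H i) + frobenius_norm_sq (H j)))"
    by (intro sum.cong refl) (simp add: sum.distrib frob)
  also have "\<dots> = 2 * (2 * (real k - 1) * (\<Sum>i<k. frobenius_norm_sq (H i)))"
    by (simp only: sum_distrib_left[symmetric] sum_off_diagonal_pairs)
  finally show ?thesis by simp
qed

text \<open>Only the diagonal blocks \<open>2 H\<^sub>i\<^sup>2\<close> contribute, and the trace of \<open>H\<^sub>i\<^sup>2\<close> is the squared Frobenius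
  norm of \<open>H\<^sub>i\<close> by hermiticity.\<close>

lemma mat_trace_anticommutator_block_mat:
  assumes H: "\<And>i. i < k \<Longrightarrow> H i \<in> carrier_mat n n" "\<And>i. i < k \<Longrightarrow> hermitian (H i)"
  shows "mat_trace (block_mat k n (\<lambda>i j. anticommutator (H i) (H j)))
    = complex_of_real (2 * (\<Sum>i<k. frobenius_norm_sq (H i)))"
proof -
  have "(\<Sum>p<n. anticommutator (H i) (H i) $$ (p, p)) = complex_of_real (2 * frobenius_norm_sq (H i))"
    if i: "i < k" for i
  proof -
    have "anticommutator (H i) (H i) $$ (p, p) = complex_of_real (2 * (\<Sum>r<n. (cmod (H i $$ (p, r)))\<^sup>2))"
      if p: "p < n" for p
    proof -
      have "H i $$ (p, r) * H i $$ (r, p) = complex_of_real ((cmod (H i $$ (p, r)))\<^sup>2)" if "r < n" for r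
        using H(2)[OF i, unfolded hermitian_iff_index[OF H(1)[OF i]], rule_format, of r p] that p
        by (simp add: complex_norm_square del: of_real_power)
      then show ?thesis
        using H(1)[OF i] p by (simp add: anticommutator_def scalar_prod_def atLeast0LessThan)
    qed
    then show ?thesis
      using H(1)[OF i] by (simp add: frobenius_norm_sq_def sum_distrib_left)
  qed
  then show ?thesis
    by (simp add: mat_trace_def sum_blocks index_block_mat sum_distrib_left
        block_mat_carrier[THEN carrier_matD(1)])
qed

theorem theorem4:
  fixes k n :: nat and H :: "nat \<Rightarrow> complex mat"
  assumes "\<And>i. i < k \<Longrightarrow> H i \<in> carrier_mat n n"
    and "\<And>i. i < k \<Longrightarrow> hermitian (H i)"
  shows "complex_of_real (trace_norm (block_mat k n (\<lambda>i j. commutator (H i) (H j))))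
    \<le> (of_nat k - 1) * mat_trace (block_mat k n (\<lambda>i j. anticommutator (H i) (H j)))"
proof -
  have "(of_nat k - 1) * mat_trace (block_mat k n (\<lambda>i j. anticommutator (H i) (H j)))
      = complex_of_real (2 * (real k - 1) * (\<Sum>i<k. frobenius_norm_sq (H i)))"
    using mat_trace_anticommutator_block_mat[of k H n] assms by simp
  then show ?thesis
    using trace_norm_commutator_block_mat_le[of k H n] assms by (simp add: less_eq_complex_def)
qed

end
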